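(* Let $p$ be a prime and $A=\{a_1,\ldots,a_d\}\subseteq\mathbf{F}_p^{\ast}$ (with $a_1,\ldots,a_d$ distinct), and let $G=(\mathbf{F}_p,E_A)$ be the Cayley graph with $E_A=\{(x,x+a):x\in\mathbf{F}_p,\ a\in A\}$. Then \[ \beta(G)\le h_p(\langle a_1,\ldots,a_d\rangle)\le\frac{dp}{2}. \]
   Context: $\mathbf{F}_p=\mathbf{Z}/p\mathbf{Z}$, $\mathbf{F}_p^\ast=\mathbf{F}_p\setminus\{0\}$. For $x\in\mathbf{F}_p$, $x\bmod p$ is the least nonnegative integer in the class $x$. For a nonzero $d$-tuple, $\langle a_1,\ldots,a_d\rangle$ denotes its class in projective space $\mathbf{P}^{d-1}(\mathbf{F}_p)$ (tuples identified up to multiplication by elements of $\mathbf{F}_p^\ast$), and its height is $h_p(\langle a_1,\ldots,a_d\rangle)=\min\{\sum_{i=1}^d(ka_i\bmod p):k=1,\ldots,p-1\}$. A directed cycle in a directed graph $(V,E)$ is a sequence of vertices $w_0,\ldots,w_n$, $n\ge1$, with $(w_j,w_{j+1})\in E$ for all $j$ and $w_n=w_0$; a graph is directed acyclic if it has none. $\beta(G)$ is the minimum size of a set $X$ of edges such that $(V,E\setminus X)$ is directed acyclic. *)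

theory Defs
  imports Complex_Main "HOL-Number_Theory.Residues"
begin

text \<open>The field with \<open>p\<close> elements, with carrier \<open>{0..p-1}\<close>; hence each element is its own least
  nonnegative representative.\<close>

abbreviation Fp :: "nat \<Rightarrow> int ring" where
  "Fp p \<equiv> residue_ring (int p)"

type_synonym 'a digraph = "'a set \<times> ('a \<times> 'a) set"

definition directed_cycle :: "'a digraph \<Rightarrow> 'a list \<Rightarrow> bool" where
  "directed_cycle G w \<longleftrightarrow> length w \<ge> 2 \<and> set w \<subseteq> fst G \<and>
     (\<forall>j. Suc j < length w \<longrightarrow> (w ! j, w ! Suc j) \<in> snd G) \<and> last w = hd w"

definition directed_acyclic :: "'a digraph \<Rightarrow> bool" where
  "directed_acyclic G \<longleftrightarrow> (\<nexists>w. directed_cycle G w)"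

text \<open>The finiteness condition only excludes infinite sets, whose \<^const>\<open>card\<close> is 0.\<close>

definition beta :: "'a digraph \<Rightarrow> nat" where
  "beta G = (LEAST n. \<exists>X \<subseteq> snd G. finite X \<and> card X = n \<and> directed_acyclic (fst G, snd G - X))"

definition cayley_graph :: "('a, 'b) ring_scheme \<Rightarrow> 'a set \<Rightarrow> 'a digraph" where
  "cayley_graph R A = (carrier R, {(x, x \<oplus>\<^bsub>R\<^esub> a) | x a. x \<in> carrier R \<and> a \<in> A})"

text \<open>A \<open>d\<close>-tuple is a list of length \<open>d\<close>.\<close>

definition nonzero_tuples :: "nat \<Rightarrow> nat \<Rightarrow> int list set" where
  "nonzero_tuples p d = {a. length a = d \<and> set a \<subseteq> carrier (Fp p) \<and> (\<exists>x \<in> set a. x \<noteq> \<zero>\<^bsub>Fp p\<^esub>)}"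

definition proj_rel :: "nat \<Rightarrow> nat \<Rightarrow> (int list \<times> int list) set" where
  "proj_rel p d = {(a, b). a \<in> nonzero_tuples p d \<and> b \<in> nonzero_tuples p d \<and>
     (\<exists>k \<in> carrier (Fp p) - {\<zero>\<^bsub>Fp p\<^esub>}. b = map (\<lambda>x. k \<otimes>\<^bsub>Fp p\<^esub> x) a)}"

definition proj_class :: "nat \<Rightarrow> int list \<Rightarrow> int list set" where
  "proj_class p a = proj_rel p (length a) `` {a}"

definition tuple_height :: "nat \<Rightarrow> int list \<Rightarrow> int" where
  "tuple_height p a = Min ((\<lambda>k. \<Sum>x\<leftarrow>a. (k * x) mod int p) ` {1..int p - 1})"

text \<open>The height of a point is the common value of \<^const>\<open>tuple_height\<close> on its representatives;
  see \<open>proj_height_proj_class\<close> below.\<close>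

definition proj_height :: "nat \<Rightarrow> int list set \<Rightarrow> int" where
  "proj_height p P = the_elem (tuple_height p ` P)"

lemma carrier_Fp: "carrier (Fp p) = {0..int p - 1}"
  and zero_Fp: "\<zero>\<^bsub>Fp p\<^esub> = 0"
  and mult_Fp: "x \<otimes>\<^bsub>Fp p\<^esub> y = (x * y) mod int p"
  by (auto simp: residue_ring_def)

lemma mult_Fp_nonzero:
  assumes "prime p" "k \<in> carrier (Fp p) - {0}" "x \<in> carrier (Fp p) - {0}"
  shows "(k * x) mod int p \<in> {1..int p - 1}"
proof -
  have "\<not> int p dvd k" "\<not> int p dvd x"
    using assms by (auto simp: carrier_Fp dest!: zdvd_imp_le)
  then have "\<not> int p dvd k * x"
    using assms(1) by (simp add: prime_dvd_mult_iff)
  moreover have "int p > 0"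
    using assms(1) prime_gt_0_nat by simp
  ultimately show ?thesis
    using pos_mod_bound[of "int p" "k * x"] pos_mod_sign[of "int p" "k * x"]
    unfolding dvd_eq_mod_eq_0 atLeastAtMost_iff by linarith
qed

lemma Fp_inverse:
  assumes "prime p" "k \<in> carrier (Fp p) - {0}"
  obtains l where "l \<in> carrier (Fp p) - {0}" "(l * k) mod int p = 1"
proof -
  have p: "int p > 1" using assms(1) prime_gt_1_nat by simp
  have nd: "\<not> int p dvd k"
    using assms by (auto simp: carrier_Fp dest!: zdvd_imp_le)
  then have "coprime k (int p)"
    using assms(1) prime_imp_coprime[of "int p" k] by (simp add: coprime_commute)
  then obtain m where m: "[k * m = 1] (mod int p)"
    using cong_solve_coprime_int by blast
  define l where "l = m mod int p"
  have lk: "(l * k) mod int p = 1"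
    using m p by (simp add: l_def cong_def mod_mult_left_eq mult.commute mod_mult_right_eq)
  have "l \<noteq> 0" using lk by auto
  then have "l \<in> carrier (Fp p) - {0}"
    using p by (auto simp: carrier_Fp l_def)
  with lk that show thesis by blast
qed

lemma scale_inverse:
  assumes "set a \<subseteq> carrier (Fp p)" "(l * k) mod int p = 1"
  shows "map (\<lambda>x. (l * x) mod int p) (map (\<lambda>x. (k * x) mod int p) a) = a"
proof -
  have "(l * ((k * x) mod int p)) mod int p = x" if "x \<in> set a" for x
  proof -
    have "(l * ((k * x) mod int p)) mod int p = ((l * k) mod int p * x) mod int p"
      by (simp add: mod_mult_right_eq mod_mult_left_eq mult.assoc)
    also have "\<dots> = x"
      using that assms by (auto simp: carrier_Fp)
    finally show ?thesis .
  qed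
  then show ?thesis by (simp add: map_idI)
qed

lemma tuple_height_scale_le:
  assumes "prime p" "k \<in> carrier (Fp p) - {0}"
  shows "tuple_height p a \<le> tuple_height p (map (\<lambda>x. (k * x) mod int p) a)"
  unfolding tuple_height_def
proof (rule Min_antimono)
  show "(\<lambda>j. \<Sum>x\<leftarrow>map (\<lambda>x. (k * x) mod int p) a. (j * x) mod int p) ` {1..int p - 1}
      \<subseteq> (\<lambda>j. \<Sum>x\<leftarrow>a. (j * x) mod int p) ` {1..int p - 1}"
  proof (rule image_subsetI)
    fix j assume j: "j \<in> {1..int p - 1}"
    have "(j * ((k * x) mod int p)) mod int p = (((j * k) mod int p) * x) mod int p" for x
      by (simp add: mod_mult_right_eq mod_mult_left_eq mult.assoc)
    then have "(\<Sum>x\<leftarrow>map (\<lambda>x. (k * x) mod int p) a. (j * x) mod int p)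
        = (\<Sum>x\<leftarrow>a. (((j * k) mod int p) * x) mod int p)"
      by (simp add: o_def)
    moreover have "(j * k) mod int p \<in> {1..int p - 1}"
      using assms j by (intro mult_Fp_nonzero) (auto simp: carrier_Fp)
    ultimately show "(\<Sum>x\<leftarrow>map (\<lambda>x. (k * x) mod int p) a. (j * x) mod int p)
        \<in> (\<lambda>j. \<Sum>x\<leftarrow>a. (j * x) mod int p) ` {1..int p - 1}"
      by blast
  qed
qed (use prime_ge_2_nat[OF assms(1)] in auto)

lemma tuple_height_scale:
  assumes "prime p" "k \<in> carrier (Fp p) - {0}" "set a \<subseteq> carrier (Fp p)"
  shows "tuple_height p (map (\<lambda>x. (k * x) mod int p) a) = tuple_height p a"
proof -
  obtain l where "l \<in> carrier (Fp p) - {0}" "(l * k) mod int p = 1"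
    using Fp_inverse[OF assms(1,2)] .
  then show ?thesis
    using tuple_height_scale_le[OF assms(1), of l "map (\<lambda>x. (k * x) mod int p) a"]
      tuple_height_scale_le[OF assms(1,2), of a] scale_inverse[OF assms(3)]
    by simp
qed

lemma equiv_proj_rel:
  assumes "prime p"
  shows "equiv (nonzero_tuples p d) (proj_rel p d)"
proof (rule equivI)
  have p: "int p > 1" using assms prime_gt_1_nat by simp
  show "proj_rel p d \<subseteq> nonzero_tuples p d \<times> nonzero_tuples p d"
    by (auto simp: proj_rel_def)
  show "refl_on (nonzero_tuples p d) (proj_rel p d)"
  proof (rule refl_onI)
    fix a assume a: "a \<in> nonzero_tuples p d"
    then have "map (\<lambda>x. (1 * x) mod int p) a = a"
      by (auto simp: nonzero_tuples_def carrier_Fp intro!: map_idI)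
    moreover have "1 \<in> carrier (Fp p) - {0}" using p by (auto simp: carrier_Fp)
    ultimately show "(a, a) \<in> proj_rel p d"
      using a unfolding proj_rel_def mult_Fp zero_Fp by (auto intro!: bexI[of _ 1])
  qed
  show "sym (proj_rel p d)"
  proof (rule symI)
    fix a b assume "(a, b) \<in> proj_rel p d"
    then obtain k where ab: "a \<in> nonzero_tuples p d" "b \<in> nonzero_tuples p d"
      and k: "k \<in> carrier (Fp p) - {0}" and b: "b = map (\<lambda>x. (k * x) mod int p) a"
      by (auto simp: proj_rel_def mult_Fp zero_Fp)
    obtain l where l: "l \<in> carrier (Fp p) - {0}" "(l * k) mod int p = 1"
      using Fp_inverse[OF assms k] .
    have "a = map (\<lambda>x. (l * x) mod int p) b"
      using scale_inverse[OF _ l(2), of a] ab b by (simp add: nonzero_tuples_def)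
    then show "(b, a) \<in> proj_rel p d"
      using ab l(1) unfolding proj_rel_def mult_Fp zero_Fp by blast
  qed
  show "trans (proj_rel p d)"
  proof (rule transI)
    fix a b c assume "(a, b) \<in> proj_rel p d" "(b, c) \<in> proj_rel p d"
    then obtain k l where ac: "a \<in> nonzero_tuples p d" "c \<in> nonzero_tuples p d"
      and k: "k \<in> carrier (Fp p) - {0}" and l: "l \<in> carrier (Fp p) - {0}"
      and b: "b = map (\<lambda>x. (k * x) mod int p) a" and c: "c = map (\<lambda>x. (l * x) mod int p) b"
      unfolding proj_rel_def mult_Fp zero_Fp by blast
    have "c = map (\<lambda>x. (((l * k) mod int p) * x) mod int p) a"
      unfolding b c by (simp add: mod_mult_right_eq mod_mult_left_eq mult.assoc)
    moreover have "(l * k) mod int p \<in> carrier (Fp p) - {0}"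
      using mult_Fp_nonzero[OF assms l k] by (auto simp: carrier_Fp)
    ultimately show "(a, c) \<in> proj_rel p d"
      using ac unfolding proj_rel_def mult_Fp zero_Fp by blast
  qed
qed

lemma proj_height_proj_class:
  assumes "prime p" "a \<in> nonzero_tuples p d"
  shows "proj_height p (proj_class p a) = tuple_height p a"
proof -
  have d: "length a = d" using assms(2) by (simp add: nonzero_tuples_def)
  have "a \<in> proj_class p a"
    using equiv_class_self[OF equiv_proj_rel[OF assms(1)] assms(2)] by (simp add: proj_class_def d)
  moreover have "tuple_height p b = tuple_height p a" if "b \<in> proj_class p a" for b
    using that tuple_height_scale[OF assms(1)]
    by (auto simp: proj_class_def proj_rel_def mult_Fp zero_Fp nonzero_tuples_def)
  ultimately have "tuple_height p ` proj_class p a = {tuple_height p a}"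
    by blast
  then show ?thesis
    by (simp add: proj_height_def)
qed

end

theory Submission
  imports Defs
begin

text \<open>Fix \<open>k\<close> with \<open>1 \<le> k < p\<close> and place the vertex \<open>x\<close> at the position \<open>kx mod p\<close>. An edge
  \<open>(x, x + a)\<close> moves forward by \<open>r = ka mod p\<close> unless it wraps around modulo \<open>p\<close>, which
  happens exactly when \<open>x\<close> lies in one of the last \<open>r\<close> positions. Deleting the wrapping edges,
  at most \<open>\<Sum>a. ka mod p\<close> in number, leaves an acyclic graph. For the upper bound on the height,
  \<open>k = 1\<close> and \<open>k = p - 1\<close> give sums that add up to \<open>dp\<close>.\<close>

text \<open>Along a directed cycle the potential \<open>f\<close> would strictly increase from the
  first vertex to the last, which are the same vertex.\<close>

lemma directed_acyclicI:
  fixes f :: "'a \<Rightarrow> 'b::order"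
  assumes "\<And>x y. (x, y) \<in> E \<Longrightarrow> f x < f y"
  shows "directed_acyclic (V, E)"
  unfolding directed_acyclic_def
proof
  assume "\<exists>w. directed_cycle (V, E) w"
  then obtain w where len: "length w \<ge> 2"
    and step: "\<And>j. Suc j < length w \<Longrightarrow> (w ! j, w ! Suc j) \<in> E" and eq: "last w = hd w"
    by (auto simp: directed_cycle_def)
  \<comment> \<open>The index starts at \<open>Suc j\<close> so that at least one edge is traversed
    and the inequality is strict; \<open>j = length w - 2\<close> reaches the last vertex.\<close>
  have "f (w ! 0) < f (w ! Suc j)" if "Suc j < length w" for j
    using that
  proof (induction j)
    case 0
    then show ?case using assms step by blast
  next
    case (Suc j)
    then show ?case using assms[OF step[of "Suc j"]] by (meson Suc_lessD order.strict_trans)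
  qed
  moreover have "Suc (length w - 2) = length w - 1" using len by simp
  ultimately have "f (w ! 0) < f (w ! (length w - 1))"
    using len by (metis Suc_1 Suc_le_lessD diff_less less_le_trans zero_less_Suc zero_less_one)
  moreover have "w \<noteq> []" using len by auto
  ultimately show False using eq by (simp add: hd_conv_nth last_conv_nth)
qed

lemma beta_le_card:
  assumes "X \<subseteq> snd G" "finite X" "directed_acyclic (fst G, snd G - X)"
  shows "beta G \<le> card X"
  unfolding beta_def using assms by (intro Least_le) blast

lemma inj_on_mult_Fp:
  assumes "prime p" "k \<in> carrier (Fp p) - {0}"
  shows "inj_on (\<lambda>x. (k * x) mod int p) (carrier (Fp p))"
proof (rule inj_onI)
  fix x y assume xy: "x \<in> carrier (Fp p)" "y \<in> carrier (Fp p)"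
    and eq: "(k * x) mod int p = (k * y) mod int p"
  obtain l where "(l * k) mod int p = 1"
    using Fp_inverse[OF assms] .
  \<comment> \<open>Scaling by \<open>l\<close> undoes scaling by \<open>k\<close>; the fact about
    tuples is applied to one-entry tuples.\<close>
  with scale_inverse[of "[x]" p l k] scale_inverse[of "[y]" p l k] xy eq
  show "x = y" by simp
qed

lemma beta_cayley_le:
  assumes p: "prime p" and k: "k \<in> {1..int p - 1}" and A: "A \<subseteq> carrier (Fp p) - {0}"
  shows "int (beta (cayley_graph (Fp p) A)) \<le> (\<Sum>a\<in>A. (k * a) mod int p)"
proof -
  define C where "C = carrier (Fp p)"
  define f where "f x = (k * x) mod int p" for x
  define G where "G = cayley_graph (Fp p) A"
  \<comment> \<open>The edges that wrap around are those along which \<open>f\<close> drops;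
    \<open>B a\<close> collects the starting points of those generated by \<open>a\<close>.\<close>
  define X where "X = {(x, y) \<in> snd G. f y < f x}"
  define B where "B a = {x \<in> C. int p \<le> f x + f a}" for a
  have kC: "k \<in> carrier (Fp p) - {0}" using k by (auto simp: carrier_Fp)
  have finC: "finite C" by (simp add: C_def carrier_Fp)
  have finA: "finite A" using A by (rule finite_subset) (simp add: carrier_Fp)
  have f: "0 \<le> f x" "f x < int p" for x
    using prime_gt_0_nat[OF p] by (auto simp: f_def)
  have fA: "0 < f a" if "a \<in> A" for a
    using mult_Fp_nonzero[OF p kC, of a] that A by (fastforce simp: f_def)
  have G: "snd G = {(x, (x + a) mod int p) | x a. x \<in> C \<and> a \<in> A}"
    by (auto simp: G_def C_def cayley_graph_def residue_ring_def)
  \<comment> \<open>Since \<open>f x + f a\<close> lies between 0 and \<open>2p - 2\<close>,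
    reduction subtracts \<open>p\<close> at most once.\<close>
  have fadd: "f ((x + a) mod int p) = (if f x + f a < int p then f x + f a else f x + f a - int p)"
    for x a
  proof -
    have "f ((x + a) mod int p) = (f x + f a) mod int p"
      by (simp add: f_def mod_mult_right_eq distrib_left mod_add_eq)
    also have "\<dots> = (if f x + f a < int p then f x + f a else f x + f a - int p)"
    proof (cases "f x + f a < int p")
      case False
      then have "(f x + f a) mod int p = (f x + f a - int p) mod int p" by simp
      also have "\<dots> = f x + f a - int p"
        using False f[of x] f[of a] by (intro mod_pos_pos_trivial) auto
      finally show ?thesis using False by simp
    qed (use f[of x] f[of a] in simp)
    finally show ?thesis .
  qed
  \<comment> \<open>\<open>f\<close> is injective and sends \<open>B a\<close> into the last
    \<open>f a\<close> positions.\<close>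
  have cardB: "int (card (B a)) \<le> f a" for a
  proof -
    have "inj_on f C"
      using inj_on_mult_Fp[OF p kC] by (simp add: C_def f_def[abs_def])
    then have "inj_on f (B a)"
      by (rule inj_on_subset) (auto simp: B_def)
    moreover have "f ` B a \<subseteq> {int p - f a..<int p}" using f by (auto simp: B_def)
    ultimately have "card (B a) \<le> card {int p - f a..<int p}"
      by (intro card_inj_on_le) auto
    then show ?thesis using f[of a] by simp
  qed
  have "X \<subseteq> (\<Union>a\<in>A. (\<lambda>x. (x, (x + a) mod int p)) ` B a)"
  proof
    fix e assume "e \<in> X"
    then obtain x a where e: "e = (x, (x + a) mod int p)" "x \<in> C" "a \<in> A"
      "f ((x + a) mod int p) < f x"
      by (auto simp: X_def G)
    \<comment> \<open>Without wrapping, \<open>f\<close> would grow by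
      \<open>f a > 0\<close>.\<close>
    then have "x \<in> B a" using fA[of a] by (auto simp: B_def fadd split: if_splits)
    with e show "e \<in> (\<Union>a\<in>A. (\<lambda>x. (x, (x + a) mod int p)) ` B a)" by blast
  qed
  moreover have finB: "finite (B a)" for a using finC by (simp add: B_def)
  ultimately have finX: "finite X"
    and "card X \<le> card (\<Union>a\<in>A. (\<lambda>x. (x, (x + a) mod int p)) ` B a)"
    using finA by (auto intro: finite_subset card_mono)
  note this(2)
  also have "\<dots> \<le> (\<Sum>a\<in>A. card ((\<lambda>x. (x, (x + a) mod int p)) ` B a))"
    using finA by (rule card_UN_le)
  also have "\<dots> \<le> (\<Sum>a\<in>A. card (B a))"
    by (intro sum_mono card_image_le finB)
  finally have "int (card X) \<le> (\<Sum>a\<in>A. int (card (B a)))"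
    by (metis of_nat_le_iff of_nat_sum)
  also have "\<dots> \<le> (\<Sum>a\<in>A. f a)"
    by (intro sum_mono cardB)
  finally have "int (card X) \<le> (\<Sum>a\<in>A. f a)" .
  moreover have "beta G \<le> card X"
  proof (rule beta_le_card[OF _ finX])
    show "directed_acyclic (fst G, snd G - X)"
    proof (rule directed_acyclicI)
      fix x y assume xy: "(x, y) \<in> snd G - X"
      then obtain a where "a \<in> A" "y = (x + a) mod int p" by (auto simp: G)
      \<comment> \<open>The change of \<open>f\<close> is \<open>f a\<close> or
        \<open>f a - p\<close>, and neither is 0 because \<open>0 < f a < p\<close>.\<close>
      then have "f y \<noteq> f x" using fA[of a] f[of a] by (auto simp: fadd)
      moreover have "\<not> f y < f x" using xy by (auto simp: X_def)
      ultimately show "f x < f y" by linarith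
    qed
  qed (auto simp: X_def)
  ultimately show ?thesis by (simp add: G_def f_def)
qed

text \<open>The factor \<open>m - 1\<close> acts as -1 modulo \<open>m\<close>, and
  \<open>m - x\<close> is already reduced.\<close>

lemma mod_complement:
  fixes x m :: int
  assumes "0 < x" "x < m"
  shows "((m - 1) * x) mod m = m - x"
proof -
  have "(m - 1) * x = (m - x) + (x - 1) * m" by (simp add: algebra_simps)
  then have "((m - 1) * x) mod m = (m - x) mod m" by simp
  also have "\<dots> = m - x" using assms by (intro mod_pos_pos_trivial) auto
  finally show ?thesis .
qed

lemma tuple_height_le:
  assumes p: "prime p" and a: "set a \<subseteq> carrier (Fp p) - {0}"
  shows "2 * tuple_height p a \<le> int (length a) * int p"
proof -
  define S where "S k = (\<Sum>x\<leftarrow>a. (k * x) mod int p)" for k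
  have "tuple_height p a \<le> S k" if "k \<in> {1..int p - 1}" for k
    unfolding tuple_height_def S_def using that by (intro Min_le) auto
  \<comment> \<open>The minimum is at most each of the two sums; for \<open>p = 2\<close> they
    coincide, which does no harm.\<close>
  from this[of 1] this[of "int p - 1"] have "2 * tuple_height p a \<le> S 1 + S (int p - 1)"
    using prime_ge_2_nat[OF p] by simp
  also have "\<dots> = (\<Sum>x\<leftarrow>a. x mod int p + ((int p - 1) * x) mod int p)"
    by (simp add: S_def sum_list_addf)
  also have "\<dots> = (\<Sum>x\<leftarrow>a. int p)"
  proof (intro arg_cong[of _ _ sum_list] map_cong refl)
    fix x assume "x \<in> set a"
    then have "x \<in> carrier (Fp p) - {0}" using a by blast
    then have "0 < x" "x < int p" by (auto simp: carrier_Fp)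
    then show "x mod int p + ((int p - 1) * x) mod int p = int p"
      by (simp add: mod_complement)
  qed
  also have "\<dots> = int (length a) * int p"
    by (simp add: sum_list_triv)
  finally show ?thesis .
qed

theorem theorem3:
  fixes p d :: nat and a :: "int list"
  assumes "prime p" and "d \<ge> 1" and "length a = d" and "distinct a"
    and "set a \<subseteq> carrier (Fp p) - {\<zero>\<^bsub>Fp p\<^esub>}"
  shows "int (beta (cayley_graph (Fp p) (set a))) \<le> proj_height p (proj_class p a) \<and>
         real_of_int (proj_height p (proj_class p a)) \<le> real d * real p / 2"
proof
  have a: "set a \<subseteq> carrier (Fp p) - {0}" using assms(5) by (simp add: zero_Fp)
  \<comment> \<open>As \<open>d \<ge> 1\<close>, there is an entry, and it is nonzero, so
    \<open>a\<close> represents a projective point.\<close>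
  have "hd a \<in> set a" using assms(2,3) by (intro hd_in_set) auto
  then have "a \<in> nonzero_tuples p d"
    using a assms(3) by (auto simp: nonzero_tuples_def zero_Fp)
  then have h: "proj_height p (proj_class p a) = tuple_height p a"
    using proj_height_proj_class[OF assms(1)] by blast
  have "tuple_height p a \<in> (\<lambda>k. \<Sum>x\<leftarrow>a. (k * x) mod int p) ` {1..int p - 1}"
    unfolding tuple_height_def using prime_ge_2_nat[OF assms(1)] by (intro Min_in) auto
  then obtain k where "k \<in> {1..int p - 1}"
    "tuple_height p a = (\<Sum>x\<leftarrow>a. (k * x) mod int p)" by blast
  \<comment> \<open>The bound is used at a \<open>k\<close> attaining the minimum; distinctness of
    the entries turns the sum over the list into the sum over the set.\<close>
  with beta_cayley_le[OF assms(1) _ a]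
  show "int (beta (cayley_graph (Fp p) (set a))) \<le> proj_height p (proj_class p a)"
    using assms(4) by (simp add: h sum_list_distinct_conv_sum_set)
  have "real_of_int (2 * tuple_height p a) \<le> real_of_int (int d * int p)"
    using tuple_height_le[OF assms(1) a] unfolding assms(3) of_int_le_iff .
  then show "real_of_int (proj_height p (proj_class p a)) \<le> real d * real p / 2"
    by (simp add: h)
qed

end
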